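(* Let $n\ge 2$ and let $\boldsymbol X=(X_1,\dots,X_n)$ and $\boldsymbol Y=(Y_1,\dots,Y_n)$ be two nonnegative random vectors with joint distribution functions $F$ and $G$, joint densities, marginal distribution functions $F_1,\dots,F_n$ and $G_1,\dots,G_n$ that are continuous and have finite expectations, and copulas $C$ and $C'$, respectively. Suppose that $C\le_{\rm whr}C'$, and that either $(X_2,\dots,X_n)\uparrow_{\rm SI}X_1$ or $(Y_2,\dots,Y_n)\uparrow_{\rm SI}Y_1$ holds. Then, for every $\boldsymbol p=(p_1,\dots,p_n)\in(0,1)^n$, $X_1\le_{\star}Y_1$ implies that $$\Delta^{\rm R}{\rm MCoVaR}_{\boldsymbol p}[X_1|X_2,\dots,X_n]\le \Delta^{\rm R}{\rm MCoVaR}_{\boldsymbol p}[Y_1|Y_2,\dots,Y_n].$$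
   Context: Throughout, "increasing" means nondecreasing. Value-at-Risk: for a random variable $X$ with distribution function $F_X$ and $p\in(0,1)$, ${\rm VaR}_p[X]=F_X^{-1}(p)=\inf\{x\in\mathbb R: F_X(x)\ge p\}$; the VaR of a conditional random variable is the quantile of its conditional distribution. Multivariate CoVaR: for $\boldsymbol p=(p_1,\dots,p_n)\in(0,1)^n$, ${\rm MCoVaR}_{\boldsymbol p}[X_1|X_2,\dots,X_n]={\rm VaR}_{p_1}\big[X_1\,\big|\,\bigcap_{j=2}^n\{X_j>{\rm VaR}_{p_j}[X_j]\}\big]$ (the conditioning event is assumed to have positive probability whenever this is written). Ratio-based contribution: $\Delta^{\rm R}{\rm MCoVaR}_{\boldsymbol p}[X_1|X_2,\dots,X_n]=\dfrac{{\rm MCoVaR}_{\boldsymbol p}[X_1|X_2,\dots,X_n]-{\rm VaR}_{p_1}[X_1]}{{\rm VaR}_{p_1}[X_1]}$, defined when ${\rm VaR}_{p_1}[X_1]\ne 0$. The same definitions apply to $\boldsymbol Y$. Copula: the copula $C$ of $\boldsymbol X$ is the joint distribution function on $[0,1]^n$ of $(U_1,\dots,U_n)$ with $U_i=F_i(X_i)$, so $F(x_1,\dots,x_n)=C(F_1(x_1),\dots,F_n(x_n))$. Its joint tail function is $\overline C(p_1,\dots,p_n)=\mathbb P(U_1>p_1,\dots,U_n>p_n)$. Similarly $C'$, $\overline{C'}$ for $\boldsymbol Y$ with $G_i(Y_i)$. Weak multivariate hazard rate order for copulas: $C\le_{\rm whr}C'$ means that $\overline{C'}(\boldsymbol p)/\overline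 C(\boldsymbol p)$ is increasing in $\boldsymbol p$ (componentwise) on $\{\boldsymbol p\in[0,1]^n:\overline C(\boldsymbol p)>0\}$. Stochastic increasingness: $(X_2,\dots,X_n)\uparrow_{\rm SI}X_1$ means that the conditional distribution of $(X_2,\dots,X_n)$ given $X_1=x_1$ is increasing in $x_1$ in the multivariate usual stochastic order, i.e. $\mathbb E[\phi(X_2,\dots,X_n)\mid X_1=x_1]$ is increasing in $x_1$ for every bounded (componentwise) increasing $\phi:\mathbb R^{n-1}\to\mathbb R$. Star order: for nonnegative random variables $X,Y$, $X\le_\star Y$ means that $F_Y^{-1}(p)/F_X^{-1}(p)$ is increasing in $p\in(0,1)$. *)

theory Defs
  imports "HOL-Probability.Probability"
begin

text \<open>
  A random vector with components indexed by a finite set \<open>I\<close> of naturals is a family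
  \<open>X :: nat \<Rightarrow> 'a \<Rightarrow> real\<close> on a probability space \<open>M\<close>; as a single random
  element it takes values in the product space over \<open>I\<close>.  Elements of that space are
  extensional functions (\<open>undefined\<close> outside \<open>I\<close>), so the pointwise order
  of functions is the componentwise order there.
\<close>

definition joint :: "nat set \<Rightarrow> (nat \<Rightarrow> 'a \<Rightarrow> real) \<Rightarrow> 'a \<Rightarrow> nat \<Rightarrow> real"
  where "joint I X = (\<lambda>\<omega>. \<lambda>i\<in>I. X i \<omega>)"

definition df :: "'a measure \<Rightarrow> ('a \<Rightarrow> real) \<Rightarrow> real \<Rightarrow> real"
  where "df M Z = cdf (distr M borel Z)"

definition VaR :: "'a measure \<Rightarrow> ('a \<Rightarrow> real) \<Rightarrow> real \<Rightarrow> real"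
  where "VaR M Z p = Inf {x. df M Z x \<ge> p}"

definition stress_event :: "nat \<Rightarrow> 'a measure \<Rightarrow> (nat \<Rightarrow> 'a \<Rightarrow> real) \<Rightarrow> (nat \<Rightarrow> real) \<Rightarrow> 'a set"
  where "stress_event n M X p = {\<omega> \<in> space M. \<forall>j\<in>{2..n}. X j \<omega> > VaR M (X j) (p j)}"

text \<open>
  \<open>uniform_measure M A\<close> is the conditional probability \<open>P(\<cdot> | A)\<close>; it is
  meaningful only if \<open>A\<close> has positive probability.
\<close>

definition MCoVaR :: "nat \<Rightarrow> 'a measure \<Rightarrow> (nat \<Rightarrow> 'a \<Rightarrow> real) \<Rightarrow> (nat \<Rightarrow> real) \<Rightarrow> real"
  where "MCoVaR n M X p = VaR (uniform_measure M (stress_event n M X p)) (X 1) (p 1)"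

definition ratio_MCoVaR :: "nat \<Rightarrow> 'a measure \<Rightarrow> (nat \<Rightarrow> 'a \<Rightarrow> real) \<Rightarrow> (nat \<Rightarrow> real) \<Rightarrow> real"
  where "ratio_MCoVaR n M X p =
    (MCoVaR n M X p - VaR M (X 1) (p 1)) / VaR M (X 1) (p 1)"

text \<open>
  A copula is represented by the law of \<open>(U\<^sub>1, \<dots>, U\<^sub>n)\<close>,
  \<open>U\<^sub>i = F\<^sub>i(X\<^sub>i)\<close>, rather than by the distribution function of that law.
\<close>

definition copula :: "nat \<Rightarrow> 'a measure \<Rightarrow> (nat \<Rightarrow> 'a \<Rightarrow> real) \<Rightarrow> (nat \<Rightarrow> real) measure"
  where "copula n M X =
    distr M (\<Pi>\<^sub>M i\<in>{1..n}. borel) (joint {1..n} (\<lambda>i \<omega>. df M (X i) (X i \<omega>)))"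

definition joint_tail :: "nat \<Rightarrow> (nat \<Rightarrow> real) measure \<Rightarrow> (nat \<Rightarrow> real) \<Rightarrow> real"
  where "joint_tail n C p = measure C {u \<in> space C. \<forall>i\<in>{1..n}. u i > p i}"

definition whr_le :: "nat \<Rightarrow> (nat \<Rightarrow> real) measure \<Rightarrow> (nat \<Rightarrow> real) measure \<Rightarrow> bool"
  where "whr_le n C C' \<longleftrightarrow>
    mono_on {p \<in> {1..n} \<rightarrow>\<^sub>E {0..1}. joint_tail n C p > 0}
      (\<lambda>p. joint_tail n C' p / joint_tail n C p)"

text \<open>
  \<open>e\<close> is a version of \<open>x \<mapsto> E[W | Z = x]\<close>.  Such versions are unique only up to
  null sets of the law of \<open>Z\<close>, so monotonicity in \<open>x\<close> is understood as the existence
  of a monotone version.  For a bounded \<open>W\<close>, a version that is monotone on a set of full measure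
  extends to a monotone version on the whole line.
\<close>

definition cond_exp_version :: "'a measure \<Rightarrow> ('a \<Rightarrow> real) \<Rightarrow> ('a \<Rightarrow> real) \<Rightarrow> (real \<Rightarrow> real) \<Rightarrow> bool"
  where "cond_exp_version M W Z e \<longleftrightarrow> e \<in> borel_measurable borel \<and>
    (AE \<omega> in M. real_cond_exp M (vimage_algebra (space M) Z borel) W \<omega> = e (Z \<omega>))"

text \<open>
  Test functions are required to be Borel, since componentwise increasing functions of several
  variables need not be.
\<close>

definition SI :: "nat \<Rightarrow> 'a measure \<Rightarrow> (nat \<Rightarrow> 'a \<Rightarrow> real) \<Rightarrow> bool"
  where "SI n M X \<longleftrightarrow>
    (\<forall>\<phi> \<in> borel_measurable (\<Pi>\<^sub>M i\<in>{2..n}. borel).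
      bounded (\<phi> ` ({2..n} \<rightarrow>\<^sub>E UNIV)) \<and> mono_on ({2..n} \<rightarrow>\<^sub>E UNIV) \<phi> \<longrightarrow>
      (\<exists>e. mono e \<and> cond_exp_version M (\<lambda>\<omega>. \<phi> (joint {2..n} X \<omega>)) (X 1) e))"

definition star_le :: "'a measure \<Rightarrow> ('a \<Rightarrow> real) \<Rightarrow> 'b measure \<Rightarrow> ('b \<Rightarrow> real) \<Rightarrow> bool"
  where "star_le M Z N W \<longleftrightarrow> mono_on {0<..<1} (\<lambda>p. VaR N W p / VaR M Z p)"

end

theory Submission
  imports Defs
begin

text \<open>
  Conditioning on the stress event turns \<open>C \<le>\<^sub>w\<^sub>h\<^sub>r C'\<close> into a usual stochastic order between the
  conditional laws of \<open>U\<^sub>1 = F\<^sub>1(X\<^sub>1)\<close> and \<open>V\<^sub>1 = G\<^sub>1(Y\<^sub>1)\<close>: compare the ratio of the tails at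
  \<open>(q, p\<^sub>2, \<dots>, p\<^sub>n)\<close> with the one at \<open>(0, p\<^sub>2, \<dots>, p\<^sub>n)\<close>.  Hence the conditional \<open>p\<^sub>1\<close>-quantiles
  \<open>u\<close>, \<open>v\<close> of \<open>U\<^sub>1\<close>, \<open>V\<^sub>1\<close> satisfy \<open>u \<le> v\<close>, while stochastic increasingness gives \<open>p\<^sub>1 \<le> u\<close> or
  \<open>p\<^sub>1 \<le> v\<close> by Chebyshev's association inequality.  The two MCoVaRs are the unconditional quantiles
  of \<open>X\<^sub>1\<close>, \<open>Y\<^sub>1\<close> at levels \<open>u\<close>, \<open>v\<close>, and the star order compares
  \<open>F\<^sub>1\<^sup>-\<^sup>1(u) / F\<^sub>1\<^sup>-\<^sup>1(p\<^sub>1)\<close> with \<open>G\<^sub>1\<^sup>-\<^sup>1(v) / G\<^sub>1\<^sup>-\<^sup>1(p\<^sub>1)\<close>.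
\<close>

section \<open>Quantiles of a single random variable\<close>

context prob_space
begin

lemma df_eq:
  assumes "random_variable borel Z"
  shows "df M Z x = prob {\<omega> \<in> space M. Z \<omega> \<le> x}"
  unfolding df_def cdf_def using assms
  by (subst measure_distr) (auto intro!: arg_cong[where f = prob])

lemma df_mono:
  assumes "random_variable borel Z" "x \<le> y"
  shows "df M Z x \<le> df M Z y"
  using assms unfolding df_eq[OF assms(1)] by (intro finite_measure_mono) auto

text \<open>The superlevel set \<open>{x. p \<le> df M Z x}\<close> is upward closed; the limits at
  both infinities make it nonempty and bounded below, and right-continuity puts its infimum into
  it.\<close>

lemma VaR_le_iff:
  assumes Z: "random_variable borel Z" and p: "0 < p" "p < 1"
  shows "VaR M Z p \<le> x \<longleftrightarrow> p \<le> df M Z x"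
proof -
  interpret D: real_distribution "distr M borel Z"
    using Z by (simp add: real_distribution_distr)
  let ?S = "{x. p \<le> df M Z x}"
  have "eventually (\<lambda>x. df M Z x < p) at_bot"
    using order_tendstoD(2)[OF D.cdf_lim_at_bot] p(1) by (simp add: df_def)
  then obtain a where a: "\<And>x. x \<le> a \<Longrightarrow> df M Z x < p"
    by (auto simp: eventually_at_bot_linorder)
  have bdd: "bdd_below ?S"
    by (rule bdd_belowI[of _ a]) (use a in \<open>metis linear mem_Collect_eq not_le\<close>)
  have "eventually (\<lambda>x. p < df M Z x) at_top"
    using order_tendstoD(1)[OF D.cdf_lim_at_top_prob] p(2) by (simp add: df_def)
  then obtain b where b: "\<And>x. x \<ge> b \<Longrightarrow> p < df M Z x"
    by (auto simp: eventually_at_top_linorder)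
  have ne: "?S \<noteq> {}"
    using less_imp_le[OF b[of b]] by auto
  have "p \<le> df M Z (Inf ?S)"
  proof (rule ccontr)
    assume "\<not> ?thesis"
    then have less: "df M Z (Inf ?S) < p"
      by simp
    have "(df M Z \<longlongrightarrow> df M Z (Inf ?S)) (at_right (Inf ?S))"
      using D.cdf_is_right_cont[of "Inf ?S"] by (simp add: continuous_within df_def)
    then have "eventually (\<lambda>x. df M Z x < p) (at_right (Inf ?S))"
      using less by (rule order_tendstoD(2))
    then obtain c where c: "c > Inf ?S" "\<And>y. Inf ?S < y \<Longrightarrow> y < c \<Longrightarrow> df M Z y < p"
      unfolding eventually_at_right_field by blast
    obtain y where y: "y \<in> ?S" "y < c"
      using cInf_lessD[OF ne c(1)] by blast
    moreover have "Inf ?S \<le> y"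
      using y bdd by (intro cInf_lower)
    ultimately show False
      using c(2)[of y] less by (cases "y = Inf ?S") auto
  qed
  then show ?thesis
    unfolding VaR_def using bdd df_mono[OF Z] by (auto intro: cInf_lower order_trans)
qed

text \<open>Strictly to the left of the quantile the distribution function stays below
  \<open>p\<close>, so continuity rules out a jump past \<open>p\<close> at the quantile.\<close>

lemma df_VaR:
  assumes Z: "random_variable borel Z" and cont: "continuous_on UNIV (df M Z)"
    and p: "0 < p" "p < 1"
  shows "df M Z (VaR M Z p) = p"
proof (rule antisym)
  let ?x = "VaR M Z p"
  have "(df M Z \<longlongrightarrow> df M Z ?x) (at_left ?x)"
    using cont by (meson UNIV_I continuous_on_eq_continuous_at open_UNIV continuous_at_imp_continuous_at_within continuous_within)
  moreover have "eventually (\<lambda>y. df M Z y \<le> p) (at_left ?x)"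
    using VaR_le_iff[OF Z p] by (auto simp: eventually_at_filter not_le[symmetric] intro!: always_eventually)
  ultimately show "df M Z ?x \<le> p"
    by (rule tendsto_upperbound) simp
  show "p \<le> df M Z ?x"
    using VaR_le_iff[OF Z p, of ?x] by simp
qed

text \<open>The two conditions can differ only if \<open>df M Z\<close> is flat at height
  \<open>p\<close>: then \<open>Z\<close> lies between \<open>VaR M Z p\<close> and the right end of
  the flat piece, where it has no mass. This translates copula coordinates into levels of
  \<open>Z\<close>.\<close>

lemma AE_df_gt_iff_VaR:
  assumes Z: "random_variable borel Z" and cont: "continuous_on UNIV (df M Z)"
    and p: "0 < p" "p < 1"
  shows "AE \<omega> in M. df M Z (Z \<omega>) > p \<longleftrightarrow> Z \<omega> > VaR M Z p"
proof -
  interpret D: real_distribution "distr M borel Z"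
    using Z by (simp add: real_distribution_distr)
  have "eventually (\<lambda>x. p < df M Z x) at_top"
    using order_tendstoD(1)[OF D.cdf_lim_at_top_prob] p(2) by (simp add: df_def)
  then obtain b where b: "\<And>x. x \<ge> b \<Longrightarrow> p < df M Z x"
    by (auto simp: eventually_at_top_linorder)
  let ?S = "{x. df M Z x \<le> p}"
  have bdd: "bdd_above ?S"
    by (rule bdd_aboveI[of _ b]) (use b in \<open>metis linear mem_Collect_eq not_le\<close>)
  have V: "VaR M Z p \<in> ?S"
    using df_VaR[OF Z cont p] by simp
  \<comment> \<open>Continuity makes the sublevel set closed, so its supremum is attained and is the
    right end of the flat piece.\<close>
  have "closed ?S"
    by (intro closed_Collect_le cont continuous_on_const)
  then have s: "Sup ?S \<in> ?S"
    using V bdd by (intro closed_contains_Sup) auto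
  have gt: "p < df M Z x \<longleftrightarrow> Sup ?S < x" for x
    using s df_mono[OF Z, of x "Sup ?S"] cSup_upper[OF _ bdd, of x] by (auto simp: not_le[symmetric])
  have le: "VaR M Z p \<le> Sup ?S"
    using V bdd by (rule cSup_upper)
  have meas[measurable]: "Z \<in> borel_measurable M"
    by fact
  have "prob {\<omega> \<in> space M. Z \<omega> \<le> Sup ?S} = prob {\<omega> \<in> space M. Z \<omega> \<le> VaR M Z p}"
    using s df_VaR[OF Z cont p] df_mono[OF Z le] unfolding df_eq[OF Z] by simp
  moreover have "{\<omega> \<in> space M. VaR M Z p < Z \<omega> \<and> Z \<omega> \<le> Sup ?S}
      = {\<omega> \<in> space M. Z \<omega> \<le> Sup ?S} - {\<omega> \<in> space M. Z \<omega> \<le> VaR M Z p}"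
    by auto
  moreover have "{\<omega> \<in> space M. Z \<omega> \<le> VaR M Z p} \<subseteq> {\<omega> \<in> space M. Z \<omega> \<le> Sup ?S}"
    using le by auto
  ultimately have "prob {\<omega> \<in> space M. VaR M Z p < Z \<omega> \<and> Z \<omega> \<le> Sup ?S} = 0"
    by (simp add: finite_measure_Diff)
  then have "AE \<omega> in M. \<not> (VaR M Z p < Z \<omega> \<and> Z \<omega> \<le> Sup ?S)"
    by (subst (asm) prob_eq_0) auto
  then show ?thesis
    by eventually_elim (unfold gt, use le in auto)
qed

text \<open>A copula tail at level 0 asks for a strictly positive coordinate; this lemma makes that
  condition vacuous. Where \<open>df M Z (Z \<omega>)\<close> is 0, almost surely \<open>Z\<close>
  is below all quantiles at levels \<open>1 / (k + 2)\<close>, an event of probability at most each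
  of these levels.\<close>

lemma AE_df_pos:
  assumes Z: "random_variable borel Z" and cont: "continuous_on UNIV (df M Z)"
  shows "AE \<omega> in M. 0 < df M Z (Z \<omega>)"
proof -
  have "AE \<omega> in M. \<forall>k::nat. df M Z (Z \<omega>) > 0 \<or> Z \<omega> \<le> VaR M Z (1 / real (k + 2))"
    unfolding AE_all_countable
  proof
    fix k :: nat
    \<comment> \<open>The shift by 2 keeps the level strictly below 1 even for
      \<open>k = 0\<close>.\<close>
    have r: "0 < 1 / real (k + 2)" "1 / real (k + 2) < 1"
      by auto
    show "AE \<omega> in M. df M Z (Z \<omega>) > 0 \<or> Z \<omega> \<le> VaR M Z (1 / real (k + 2))"
      using AE_df_gt_iff_VaR[OF Z cont r] by eventually_elim (use r in linarith)
  qed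
  moreover have "AE \<omega> in M. \<not> (\<forall>k::nat. Z \<omega> \<le> VaR M Z (1 / real (k + 2)))"
  proof -
    have meas[measurable]: "Z \<in> borel_measurable M"
      by fact
    have "prob {\<omega> \<in> space M. \<forall>k::nat. Z \<omega> \<le> VaR M Z (1 / real (k + 2))} \<le> 1 / real (k + 2)" for k
    proof -
      have "prob {\<omega> \<in> space M. \<forall>k::nat. Z \<omega> \<le> VaR M Z (1 / real (k + 2))}
          \<le> prob {\<omega> \<in> space M. Z \<omega> \<le> VaR M Z (1 / real (k + 2))}"
        by (intro finite_measure_mono) auto
      also have "\<dots> = 1 / real (k + 2)"
        using df_VaR[OF Z cont, of "1 / real (k + 2)"] by (simp add: df_eq[OF Z])
      finally show ?thesis .
    qed
    moreover have "(\<lambda>k. 1 / real (k + 2)) \<longlonglongrightarrow> 0"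
      using LIMSEQ_Suc[OF LIMSEQ_inverse_real_of_nat] by (simp add: inverse_eq_divide)
    ultimately have "prob {\<omega> \<in> space M. \<forall>k::nat. Z \<omega> \<le> VaR M Z (1 / real (k + 2))} \<le> 0"
      by (intro LIMSEQ_le_const[of _ 0]) auto
    then have "prob {\<omega> \<in> space M. \<forall>k::nat. Z \<omega> \<le> VaR M Z (1 / real (k + 2))} = 0"
      by (simp add: measure_le_0_iff)
    then show ?thesis
      by (subst (asm) prob_eq_0) auto
  qed
  ultimately show ?thesis
    by eventually_elim auto
qed

text \<open>There is no mass on the negative axis, and continuity excludes an atom at 0, so
  \<open>df M Z 0\<close> is still 0. Positivity permits dividing by quantiles later.\<close>

lemma VaR_pos:
  assumes Z: "random_variable borel Z" and cont: "continuous_on UNIV (df M Z)"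
    and nonneg: "AE \<omega> in M. 0 \<le> Z \<omega>" and p: "0 < p" "p < 1"
  shows "0 < VaR M Z p"
proof -
  have meas[measurable]: "Z \<in> borel_measurable M"
    by fact
  have "df M Z x = 0" if "x < 0" for x
    unfolding df_eq[OF Z] using nonneg that by (subst prob_eq_0) (auto elim!: eventually_mono)
  moreover have "(df M Z \<longlongrightarrow> df M Z 0) (at_left 0)"
    using cont by (meson UNIV_I continuous_on_eq_continuous_at open_UNIV continuous_at_imp_continuous_at_within continuous_within)
  ultimately have "df M Z 0 \<le> 0"
    by (intro tendsto_upperbound[of "df M Z"]) (auto simp: eventually_at_filter)
  then show ?thesis
    using VaR_le_iff[OF Z p, of 0] p by linarith
qed

lemma VaR_mono:
  assumes Z: "random_variable borel Z" and p: "0 < p" "p \<le> q" "q < 1"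
  shows "VaR M Z p \<le> VaR M Z q"
  using VaR_le_iff[OF Z, of q "VaR M Z q"] VaR_le_iff[OF Z, of p "VaR M Z q"] p by auto

section \<open>Quantiles under conditioning on an event\<close>

lemma df_uniform_measure:
  assumes Z: "random_variable borel Z" and A: "A \<in> events" "prob A > 0"
  shows "df (uniform_measure M A) Z x = prob (A \<inter> {\<omega> \<in> space M. Z \<omega> \<le> x}) / prob A"
proof -
  have em: "emeasure M A \<noteq> 0" "emeasure M A \<noteq> \<infinity>"
    using A by (auto simp: emeasure_eq_measure)
  interpret U: prob_space "uniform_measure M A"
    using em by (rule prob_space_uniform_measure)
  have meas[measurable]: "Z \<in> borel_measurable M"
    by fact
  show ?thesis
    using A em by (subst U.df_eq) (auto simp: measure_uniform_measure)
qed

text \<open>Conditioning creates no atoms, so the conditional quantile \<open>x\<close> hits its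
  level exactly. The last claims make \<open>x\<close> an unconditional quantile, at level
  \<open>df M Z x\<close>: it cannot sit inside or at the right end of a flat piece, since there is
  conditional mass immediately to its left.\<close>

lemma conditional_VaR:
  fixes Z A p
  defines "x \<equiv> VaR (uniform_measure M A) Z p"
  assumes Z: "random_variable borel Z" and cont: "continuous_on UNIV (df M Z)"
    and A: "A \<in> events" "prob A > 0" and p: "0 < p" "p < 1"
  shows "prob (A \<inter> {\<omega> \<in> space M. Z \<omega> \<le> x}) = p * prob A"
    and "\<And>y. y < x \<Longrightarrow> prob (A \<inter> {\<omega> \<in> space M. Z \<omega> \<le> y}) < p * prob A"
    and "0 < df M Z x" "df M Z x < 1" "VaR M Z (df M Z x) = x"
proof -
  have em: "emeasure M A \<noteq> 0" "emeasure M A \<noteq> \<infinity>"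
    using A by (auto simp: emeasure_eq_measure)
  interpret U: prob_space "uniform_measure M A"
    using em by (rule prob_space_uniform_measure)
  have meas[measurable]: "Z \<in> borel_measurable M"
    by fact
  have UZ: "U.random_variable borel Z"
    by simp
  interpret D: real_distribution "distr M borel Z"
    using Z by (simp add: real_distribution_distr)
  interpret DU: real_distribution "distr (uniform_measure M A) borel Z"
    using UZ by (simp add: U.real_distribution_distr)
  \<comment> \<open>A conditional atom at \<open>y\<close> would force an unconditional one, because
    \<open>A \<inter> {Z = y}\<close> is contained in \<open>{Z = y}\<close>.\<close>
  have contU: "continuous_on UNIV (df (uniform_measure M A) Z)"
  proof -
    have "isCont (df (uniform_measure M A) Z) y" for y
    proof -
      have "measure (distr M borel Z) {y} = 0"
        using cont D.isCont_cdf by (simp add: df_def continuous_on_eq_continuous_at)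
      then have 0: "prob (Z -` {y} \<inter> space M) = 0"
        by (simp add: measure_distr)
      have "prob (A \<inter> (Z -` {y} \<inter> space M)) \<le> prob (Z -` {y} \<inter> space M)"
        by (intro finite_measure_mono) auto
      with 0 have "prob (A \<inter> (Z -` {y} \<inter> space M)) = 0"
        by (simp add: measure_le_0_iff)
      then have "measure (distr (uniform_measure M A) borel Z) {y} = 0"
        using em A by (subst measure_distr) (auto simp: measure_uniform_measure)
      then show ?thesis
        using DU.isCont_cdf by (simp add: df_def)
    qed
    then show ?thesis
      by (simp add: continuous_on_eq_continuous_at)
  qed
  show eq: "prob (A \<inter> {\<omega> \<in> space M. Z \<omega> \<le> x}) = p * prob A"
    using U.df_VaR[OF UZ contU p] A(2) unfolding x_def df_uniform_measure[OF Z A]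
    by (simp add: field_simps)
  show less: "prob (A \<inter> {\<omega> \<in> space M. Z \<omega> \<le> y}) < p * prob A" if "y < x" for y
    using U.VaR_le_iff[OF UZ p, of y] that A(2) unfolding df_uniform_measure[OF Z A] x_def
    by (simp add: field_simps not_le[symmetric])
  \<comment> \<open>The joint masses \<open>p * prob A\<close> up to \<open>x\<close> and
    \<open>(1 - p) * prob A\<close> beyond it bound the unconditional masses from below, keeping
    \<open>df M Z x\<close> off both 0 and 1.\<close>
  have "p * prob A \<le> df M Z x"
    unfolding eq[symmetric] df_eq[OF Z] by (intro finite_measure_mono) auto
  then show pos: "0 < df M Z x"
    using p A(2) by (smt (verit) mult_pos_pos)
  have split: "prob A = prob (A \<inter> {\<omega> \<in> space M. Z \<omega> \<le> x}) + prob (A - {\<omega> \<in> space M. Z \<omega> \<le> x})"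
    using A by (subst finite_measure_Diff') auto
  have "prob (A - {\<omega> \<in> space M. Z \<omega> \<le> x}) \<le> prob (space M - {\<omega> \<in> space M. Z \<omega> \<le> x})"
    using A sets.sets_into_space by (intro finite_measure_mono) auto
  also have "\<dots> = 1 - df M Z x"
    unfolding df_eq[OF Z] by (intro prob_compl) auto
  finally have "(1 - p) * prob A \<le> 1 - df M Z x"
    using split eq by (simp add: algebra_simps)
  moreover have "0 < (1 - p) * prob A"
    using p A by simp
  ultimately show lt1: "df M Z x < 1"
    by linarith
  show "VaR M Z (df M Z x) = x"
  proof (rule antisym)
    show "VaR M Z (df M Z x) \<le> x"
      using VaR_le_iff[OF Z pos lt1] by simp
    show "x \<le> VaR M Z (df M Z x)"
    proof (rule ccontr)
      let ?y = "VaR M Z (df M Z x)"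
      assume "\<not> x \<le> ?y"
      then have y: "?y < x"
        by simp
      have sub: "{\<omega> \<in> space M. Z \<omega> \<le> ?y} \<subseteq> {\<omega> \<in> space M. Z \<omega> \<le> x}"
        using y by auto
      \<comment> \<open>If \<open>?y < x\<close> had the same height, \<open>Z\<close> would have no
        mass between them, hence none within \<open>A\<close>, against the strict inequality
        \<open>less\<close>.\<close>
      have "prob (A \<inter> {\<omega> \<in> space M. Z \<omega> \<le> x}) - prob (A \<inter> {\<omega> \<in> space M. Z \<omega> \<le> ?y})
          = prob (A \<inter> {\<omega> \<in> space M. Z \<omega> \<le> x} - A \<inter> {\<omega> \<in> space M. Z \<omega> \<le> ?y})"
        using y A by (subst finite_measure_Diff) auto
      also have "\<dots> \<le> prob ({\<omega> \<in> space M. Z \<omega> \<le> x} - {\<omega> \<in> space M. Z \<omega> \<le> ?y})"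
        by (intro finite_measure_mono) auto
      also have "\<dots> = df M Z x - df M Z ?y"
        using finite_measure_Diff[OF _ _ sub] by (simp add: df_eq[OF Z])
      also have "\<dots> = 0"
        using df_VaR[OF Z cont pos lt1] by simp
      finally show False
        using less[OF y] eq by simp
    qed
  qed
qed

section \<open>Copula tails as probabilities of stress events\<close>

lemma joint_tail_copula:
  assumes X: "\<And>i. i \<in> {1..n} \<Longrightarrow> random_variable borel (X i)"
    and cont: "\<And>i. i \<in> {1..n} \<Longrightarrow> continuous_on UNIV (df M (X i))"
  shows "joint_tail n (copula n M X) q = prob {\<omega> \<in> space M. \<forall>i\<in>{1..n}. df M (X i) (X i \<omega>) > q i}"
proof -
  have [measurable]: "(\<lambda>\<omega>. df M (X i) (X i \<omega>)) \<in> borel_measurable M" if "i \<in> {1..n}" for i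
    using borel_measurable_continuous_onI[OF cont[OF that]] X[OF that] by measurable
  have "joint {1..n} (\<lambda>i \<omega>. df M (X i) (X i \<omega>)) \<in> measurable M (\<Pi>\<^sub>M i\<in>{1..n}. borel)"
    unfolding joint_def by measurable
  then show ?thesis
    unfolding joint_tail_def copula_def
    by (subst measure_distr) (auto simp: joint_def space_PiM intro!: arg_cong[where f = prob])
qed

lemma sets_stress_event:
  assumes X: "\<And>i. i \<in> {1..n} \<Longrightarrow> random_variable borel (X i)"
  shows "stress_event n M X p \<in> events"
proof -
  have [measurable]: "X i \<in> borel_measurable M" if "i \<in> {2..n}" for i
    using X that by auto
  show ?thesis
    unfolding stress_event_def by measurable
qed

text \<open>Almost surely, the coordinates from 2 on describe the stress event. Level 0 in
  coordinate 1 adds no constraint, and level \<open>q\<close> adds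
  \<open>X 1 > VaR M (X 1) q\<close>; so the quotient of the two tails is a conditional tail of the
  first copula coordinate.\<close>

lemma joint_tail_copula_stress:
  fixes p :: "nat \<Rightarrow> real"
  assumes X: "\<And>i. i \<in> {1..n} \<Longrightarrow> random_variable borel (X i)"
    and cont: "\<And>i. i \<in> {1..n} \<Longrightarrow> continuous_on UNIV (df M (X i))"
    and p: "\<And>i. i \<in> {1..n} \<Longrightarrow> 0 < p i \<and> p i < 1" and n: "1 \<le> n"
  shows "joint_tail n (copula n M X) (p(1 := 0)) = prob (stress_event n M X p)"
    and "0 < q \<Longrightarrow> q < 1 \<Longrightarrow> joint_tail n (copula n M X) (p(1 := q))
      = prob (stress_event n M X p) - prob (stress_event n M X p \<inter> {\<omega> \<in> space M. X 1 \<omega> \<le> VaR M (X 1) q})"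
proof -
  have [measurable]: "(\<lambda>\<omega>. df M (X i) (X i \<omega>)) \<in> borel_measurable M" if "i \<in> {1..n}" for i
    using borel_measurable_continuous_onI[OF cont[OF that]] X[OF that] by measurable
  have [measurable]: "X 1 \<in> borel_measurable M"
    using X n by auto
  note A = sets_stress_event[of n X p, OF X]
  have I: "{Suc 0..n} = insert (Suc 0) {2..n}"
    using n by auto
  have "AE \<omega> in M. \<forall>i\<in>{2..n}. df M (X i) (X i \<omega>) > p i \<longleftrightarrow> X i \<omega> > VaR M (X i) (p i)"
    using X cont p by (intro AE_finite_allI AE_df_gt_iff_VaR) auto
  then have AE: "AE \<omega> in M. (\<forall>i\<in>{2..n}. df M (X i) (X i \<omega>) > p i) \<longleftrightarrow> \<omega> \<in> stress_event n M X p"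
    using AE_space by eventually_elim (auto simp: stress_event_def)
  have tail: "joint_tail n (copula n M X) q = prob {\<omega> \<in> space M. \<forall>i\<in>{1..n}. df M (X i) (X i \<omega>) > q i}" for q
    using X cont by (rule joint_tail_copula)
  show "joint_tail n (copula n M X) (p(1 := 0)) = prob (stress_event n M X p)"
    unfolding tail
  proof (rule finite_measure_eq_AE)
    have "AE \<omega> in M. 0 < df M (X 1) (X 1 \<omega>)"
      using X cont n by (intro AE_df_pos) auto
    with AE show "AE \<omega> in M. \<omega> \<in> {\<omega> \<in> space M. \<forall>i\<in>{1..n}. (p(1 := 0)) i < df M (X i) (X i \<omega>)}
        \<longleftrightarrow> \<omega> \<in> stress_event n M X p"
      using AE_space by eventually_elim (auto simp: I)
  qed (use A in measurable)
  assume q: "0 < q" "q < 1"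
  have "joint_tail n (copula n M X) (p(1 := q))
      = prob (stress_event n M X p - {\<omega> \<in> space M. X 1 \<omega> \<le> VaR M (X 1) q})"
    unfolding tail
  proof (rule finite_measure_eq_AE)
    have "AE \<omega> in M. df M (X 1) (X 1 \<omega>) > q \<longleftrightarrow> X 1 \<omega> > VaR M (X 1) q"
      using X cont n q by (intro AE_df_gt_iff_VaR) auto
    with AE show "AE \<omega> in M. \<omega> \<in> {\<omega> \<in> space M. \<forall>i\<in>{1..n}. (p(1 := q)) i < df M (X i) (X i \<omega>)}
        \<longleftrightarrow> \<omega> \<in> stress_event n M X p - {\<omega> \<in> space M. X 1 \<omega> \<le> VaR M (X 1) q}"
      using AE_space by eventually_elim (auto simp: I)
  qed (use A in measurable)
  moreover have "{\<omega> \<in> space M. X 1 \<omega> \<le> VaR M (X 1) q} \<in> events"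
    by measurable
  ultimately show "joint_tail n (copula n M X) (p(1 := q)) = prob (stress_event n M X p)
      - prob (stress_event n M X p \<inter> {\<omega> \<in> space M. X 1 \<omega> \<le> VaR M (X 1) q})"
    using finite_measure_Diff'[OF A] by simp
qed

section \<open>Negative association of stress events with lower tails\<close>

text \<open>Chebyshev's argument with pivot \<open>e x\<close>: the monotone version
  \<open>e\<close> of the conditional probability of \<open>A\<close> is at most \<open>e x\<close>
  on \<open>{Z \<le> x}\<close> and at least \<open>e x\<close> on the complement.\<close>

lemma mono_cond_exp_le:
  assumes Z: "random_variable borel Z" and A: "A \<in> events"
    and W: "\<And>\<omega>. \<omega> \<in> space M \<Longrightarrow> W \<omega> = indicator A \<omega>"
    and e: "mono e" "cond_exp_version M W Z e"
  shows "prob (A \<inter> {\<omega> \<in> space M. Z \<omega> \<le> x}) \<le> prob A * prob {\<omega> \<in> space M. Z \<omega> \<le> x}"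
proof -
  have [measurable]: "Z \<in> borel_measurable M"
    by fact
  define B where "B = {\<omega> \<in> space M. Z \<omega> \<le> x}"
  define B' where "B' = {\<omega> \<in> space M. x < Z \<omega>}"
  have meas[measurable]: "B \<in> events" "B' \<in> events"
    unfolding B_def B'_def by measurable
  let ?F = "vimage_algebra (space M) Z borel"
  have sub: "subalgebra M ?F"
    unfolding subalgebra_def using Z by (auto simp: sets_vimage_algebra2 measurable_sets)
  interpret finite_measure_subalgebra M ?F
    by unfold_locales (rule sub)
  have BF: "B \<in> sets ?F" "B' \<in> sets ?F"
  proof -
    have "B = Z -` {..x} \<inter> space M" "B' = Z -` {x<..} \<inter> space M"
      by (auto simp: B_def B'_def)
    then show "B \<in> sets ?F" "B' \<in> sets ?F"
      by (auto intro!: in_vimage_algebra)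
  qed
  have int: "integrable M W"
    using A by (subst Bochner_Integration.integrable_cong[OF refl W]) (auto simp: emeasure_eq_measure)
  have [measurable]: "e \<in> borel_measurable borel"
    using e(2) by (simp add: cond_exp_version_def)
  have AE: "AE \<omega> in M. real_cond_exp M ?F W \<omega> = e (Z \<omega>)"
    using e(2) by (simp add: cond_exp_version_def)
  have inte: "integrable M (\<lambda>\<omega>. e (Z \<omega>))"
    using real_cond_exp_int(1)[OF int] AE by (subst (asm) integrable_cong_AE) auto
  \<comment> \<open>The defining property of conditional expectation, available only for events
    \<open>S\<close> generated by \<open>Z\<close>.\<close>
  have prob_eq: "prob (A \<inter> S) = (\<integral>\<omega>. indicator S \<omega> * e (Z \<omega>) \<partial>M)" if S: "S \<in> sets ?F" "S \<in> events" for S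
  proof -
    have "prob (A \<inter> S) = (\<integral>\<omega>. indicator S \<omega> * indicator A \<omega> \<partial>M)"
      using A S by (simp add: indicator_inter_arith[symmetric] Int_commute)
    also have "\<dots> = (\<integral>\<omega>. indicator S \<omega> * W \<omega> \<partial>M)"
      using W by (intro Bochner_Integration.integral_cong) auto
    also have "\<dots> = (\<integral>\<omega>. indicator S \<omega> * real_cond_exp M ?F W \<omega> \<partial>M)"
      using real_cond_exp_intA[OF int S(1)] by (simp add: set_lebesgue_integral_def)
    also have "\<dots> = (\<integral>\<omega>. indicator S \<omega> * e (Z \<omega>) \<partial>M)"
      using AE S by (intro integral_cong_AE) auto
    finally show ?thesis .
  qed
  have intS: "integrable M (\<lambda>\<omega>. indicator S \<omega> * e (Z \<omega>))" if "S \<in> events" for S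
    using integrable_mult_indicator[OF that inte] by simp
  have intC: "integrable M (\<lambda>\<omega>. indicator S \<omega> * c)" if "S \<in> events" for S and c :: real
    using that by (auto simp: emeasure_eq_measure)
  have "prob (A \<inter> B) \<le> (\<integral>\<omega>. indicator B \<omega> * e x \<partial>M)"
    unfolding prob_eq[OF BF(1) meas(1)] using monoD[OF e(1)]
    by (intro integral_mono intS intC meas) (auto simp: B_def indicator_def)
  then have 1: "prob (A \<inter> B) \<le> e x * prob B"
    by (simp add: mult.commute)
  have "(\<integral>\<omega>. indicator B' \<omega> * e x \<partial>M) \<le> prob (A \<inter> B')"
    unfolding prob_eq[OF BF(2) meas(2)] using monoD[OF e(1)]
    by (intro integral_mono intS intC meas) (auto simp: B'_def indicator_def)
  then have 2: "e x * prob B' \<le> prob (A \<inter> B')"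
    by (simp add: mult.commute)
  have B': "B' = space M - B"
    by (auto simp: B_def B'_def)
  have 3: "prob B' = 1 - prob B"
    unfolding B' by (rule prob_compl) simp
  have "A \<inter> B' = A - B"
    using A sets.sets_into_space by (auto simp: B')
  then have 4: "prob (A \<inter> B') = prob A - prob (A \<inter> B)"
    using A by (simp add: finite_measure_Diff')
  \<comment> \<open>Cross-multiplying the two bounds eliminates the pivot; with
    \<open>prob B' = 1 - prob B\<close> the products \<open>prob (A \<inter> B) * prob B\<close>
    then cancel.\<close>
  have "prob (A \<inter> B) * prob B' \<le> e x * prob B * prob B'"
    using 1 by (intro mult_right_mono) auto
  also have "\<dots> \<le> prob (A \<inter> B') * prob B"
    using mult_right_mono[OF 2, of "prob B"] by (simp add: mult_ac)
  finally show ?thesis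
    using 3 4 unfolding B_def[symmetric] by (simp add: algebra_simps)
qed

text \<open>The stress event is the preimage of an open upper orthant \<open>S\<close>, whose
  indicator is a bounded increasing test function.\<close>

lemma SI_stress_event_le:
  assumes X: "\<And>i. i \<in> {1..n} \<Longrightarrow> random_variable borel (X i)" and n: "1 \<le> n"
    and SI: "SI n M X"
  shows "prob (stress_event n M X p \<inter> {\<omega> \<in> space M. X 1 \<omega> \<le> x})
    \<le> prob (stress_event n M X p) * df M (X 1) x"
proof -
  define S where "S = {y \<in> {2..n} \<rightarrow>\<^sub>E UNIV. \<forall>j\<in>{2..n}. y j > VaR M (X j) (p j)}"
  have S: "S = {y \<in> space (\<Pi>\<^sub>M i\<in>{2..n}. borel). \<forall>j\<in>{2..n}. y j > VaR M (X j) (p j)}"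
    by (simp add: S_def space_PiM)
  have "S \<in> sets (\<Pi>\<^sub>M i\<in>{2..n}. borel)"
    unfolding S by measurable
  then have 1: "indicator S \<in> borel_measurable (\<Pi>\<^sub>M i\<in>{2..n}. borel :: real measure)"
    by (rule borel_measurable_indicator)
  have 2: "bounded (indicator S ` ({2..n} \<rightarrow>\<^sub>E UNIV) :: real set)"
    by (rule bounded_subset[of "{0, 1}"]) (auto simp: indicator_def)
  have 3: "mono_on ({2..n} \<rightarrow>\<^sub>E UNIV) (indicator S :: _ \<Rightarrow> real)"
    by (rule mono_onI) (auto simp: indicator_def S_def le_fun_def intro: less_le_trans)
  obtain e where e: "mono e" "cond_exp_version M (\<lambda>\<omega>. indicator S (joint {2..n} X \<omega>)) (X 1) e"
    using SI 1 2 3 unfolding SI_def by blast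
  have "prob (stress_event n M X p \<inter> {\<omega> \<in> space M. X 1 \<omega> \<le> x})
      \<le> prob (stress_event n M X p) * prob {\<omega> \<in> space M. X 1 \<omega> \<le> x}"
    using X n by (intro mono_cond_exp_le[OF _ sets_stress_event[OF X] _ e])
      (auto simp: S_def joint_def stress_event_def indicator_def)
  then show ?thesis
    using X[of 1] n by (simp add: df_eq)
qed

end

section \<open>Comparison of the two ratios\<close>

lemma random_variable_component:
  assumes "distributed M (\<Pi>\<^sub>M i\<in>I. lborel) (joint I X) f" "i \<in> I"
  shows "X i \<in> borel_measurable M"
proof -
  have "joint I X \<in> measurable M (\<Pi>\<^sub>M i\<in>I. lborel)"
    using assms(1) by (rule distributed_measurable)
  from measurable_compose[OF this measurable_component_singleton[OF assms(2)]]
  show ?thesis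
    using assms(2) by (simp add: joint_def)
qed

theorem theorem3p4:
  fixes n :: nat
    and M :: "'a measure" and X :: "nat \<Rightarrow> 'a \<Rightarrow> real" and f :: "(nat \<Rightarrow> real) \<Rightarrow> ennreal"
    and N :: "'b measure" and Y :: "nat \<Rightarrow> 'b \<Rightarrow> real" and g :: "(nat \<Rightarrow> real) \<Rightarrow> ennreal"
    and p :: "nat \<Rightarrow> real"
  assumes "n \<ge> 2"
    and "prob_space M" and "prob_space N"
    and "distributed M (\<Pi>\<^sub>M i\<in>{1..n}. lborel) (joint {1..n} X) f"
    and "distributed N (\<Pi>\<^sub>M i\<in>{1..n}. lborel) (joint {1..n} Y) g"
    and "\<And>i. i \<in> {1..n} \<Longrightarrow> AE \<omega> in M. 0 \<le> X i \<omega>"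
    and "\<And>i. i \<in> {1..n} \<Longrightarrow> AE \<omega> in N. 0 \<le> Y i \<omega>"
    and "\<And>i. i \<in> {1..n} \<Longrightarrow> continuous_on UNIV (df M (X i))"
    and "\<And>i. i \<in> {1..n} \<Longrightarrow> continuous_on UNIV (df N (Y i))"
    and "\<And>i. i \<in> {1..n} \<Longrightarrow> integrable M (X i)"
    and "\<And>i. i \<in> {1..n} \<Longrightarrow> integrable N (Y i)"
    and "whr_le n (copula n M X) (copula n N Y)"
    and "SI n M X \<or> SI n N Y"
    and "\<And>i. i \<in> {1..n} \<Longrightarrow> 0 < p i \<and> p i < 1"
    and "measure M (stress_event n M X p) > 0"
    and "measure N (stress_event n N Y p) > 0"
    and "star_le M (X 1) N (Y 1)"
  shows "ratio_MCoVaR n M X p \<le> ratio_MCoVaR n N Y p"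
proof -
  interpret M: prob_space M by fact
  interpret N: prob_space N by fact
  note X = random_variable_component[OF assms(4)]
  note Y = random_variable_component[OF assms(5)]
  have 1: "1 \<in> {1..n}" "1 \<le> n"
    using \<open>n \<ge> 2\<close> by auto
  note X1 = X[OF 1(1)] and Y1 = Y[OF 1(1)]
  note cX = assms(8) and cY = assms(9)
  note p = assms(14)
  define A where "A = stress_event n M X p"
  define B where "B = stress_event n N Y p"
  have A: "A \<in> sets M" "M.prob A > 0"
    using M.sets_stress_event[OF X] assms(15) by (auto simp: A_def)
  have B: "B \<in> sets N" "N.prob B > 0"
    using N.sets_stress_event[OF Y] assms(16) by (auto simp: B_def)
  have p1: "0 < p 1" "p 1 < 1"
    using p[OF 1(1)] by auto
  define x where "x = VaR (uniform_measure M A) (X 1) (p 1)"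
  define y where "y = VaR (uniform_measure N B) (Y 1) (p 1)"
  define u where "u = df M (X 1) x"
  define v where "v = df N (Y 1) y"
  note x = M.conditional_VaR[OF X1 cX[OF 1(1)] A p1, folded x_def, folded u_def]
  note y = N.conditional_VaR[OF Y1 cY[OF 1(1)] B p1, folded y_def, folded v_def]
  have uv: "u \<le> v"
  proof (rule ccontr)
    assume "\<not> u \<le> v"
    \<comment> \<open>From \<open>v < u\<close> the \<open>v\<close>-quantile is at most
      \<open>x\<close>; equality would give \<open>u = v\<close> by continuity.\<close>
    then have "VaR M (X 1) v < x"
      using M.VaR_le_iff[OF X1 y(3,4), of x] M.df_VaR[OF X1 cX[OF 1(1)] y(3,4)]
      by (cases "VaR M (X 1) v = x") (auto simp: u_def)
    then have less: "M.prob (A \<inter> {\<omega> \<in> space M. X 1 \<omega> \<le> VaR M (X 1) v}) < p 1 * M.prob A"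
      by (rule x(2))
    have tX: "joint_tail n (copula n M X) (p(1 := 0)) = M.prob A"
        "joint_tail n (copula n M X) (p(1 := v))
          = M.prob A - M.prob (A \<inter> {\<omega> \<in> space M. X 1 \<omega> \<le> VaR M (X 1) v})"
      unfolding A_def by (intro M.joint_tail_copula_stress X cX p 1(2) y(3,4); assumption)+
    have tY: "joint_tail n (copula n N Y) (p(1 := 0)) = N.prob B"
        "joint_tail n (copula n N Y) (p(1 := v))
          = N.prob B - N.prob (B \<inter> {\<omega> \<in> space N. Y 1 \<omega> \<le> VaR N (Y 1) v})"
      unfolding B_def by (intro N.joint_tail_copula_stress Y cY p 1(2) y(3,4); assumption)+
    have restrict: "joint_tail n C (restrict q {1..n}) = joint_tail n C q" for C q
      unfolding joint_tail_def by (intro arg_cong[where f = "measure C"]) auto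
    \<comment> \<open>The order \<open>whr_le\<close> quantifies over extensional points, hence the
      restriction; tails ignore the other coordinates.\<close>
    let ?q = "\<lambda>t. restrict (p(1 := t)) {1..n}"
    have eqs: "joint_tail n (copula n M X) (?q 0) = M.prob A"
        "joint_tail n (copula n N Y) (?q 0) = N.prob B"
        "joint_tail n (copula n M X) (?q v)
          = M.prob A - M.prob (A \<inter> {\<omega> \<in> space M. X 1 \<omega> \<le> VaR M (X 1) v})"
        "joint_tail n (copula n N Y) (?q v) = (1 - p 1) * N.prob B"
      unfolding restrict tX tY
      using y(1,5) by (simp_all add: algebra_simps)
    have "p 1 * M.prob A \<le> M.prob A"
      using p1 A by (simp add: mult_le_cancel_right1)
    \<comment> \<open>The conditional tail at level \<open>v\<close> strictly exceeds
      \<open>1 - p 1\<close> for \<open>X\<close>, but equals \<open>1 - p 1\<close> for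
      \<open>Y\<close>, since \<open>y\<close> is the \<open>v\<close>-quantile. The monotone ratio
      between levels 0 and \<open>v\<close> forbids this.\<close>
    with less have tail: "(1 - p 1) * M.prob A < joint_tail n (copula n M X) (?q v)"
        and pos: "joint_tail n (copula n M X) (?q v) > 0"
      unfolding eqs by (auto simp: algebra_simps)
    moreover have pos0: "joint_tail n (copula n M X) (?q 0) > 0"
      using A(2) by (simp only: eqs)
    ultimately have "?q 0 \<in> {q \<in> {1..n} \<rightarrow>\<^sub>E {0..1}. joint_tail n (copula n M X) q > 0}"
        "?q v \<in> {q \<in> {1..n} \<rightarrow>\<^sub>E {0..1}. joint_tail n (copula n M X) q > 0}"
      using p y(3,4) by (auto simp: less_imp_le)
    moreover have "?q 0 \<le> ?q v"
      using y(3) by (auto simp: le_fun_def)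
    ultimately have "joint_tail n (copula n N Y) (?q 0) / joint_tail n (copula n M X) (?q 0)
        \<le> joint_tail n (copula n N Y) (?q v) / joint_tail n (copula n M X) (?q v)"
      using assms(12) unfolding whr_le_def by (rule mono_onD[rotated])
    then have "N.prob B / M.prob A \<le> (1 - p 1) * N.prob B / joint_tail n (copula n M X) (?q v)"
      unfolding eqs(1,2,4) .
    then have "N.prob B * joint_tail n (copula n M X) (?q v) \<le> N.prob B * ((1 - p 1) * M.prob A)"
      using A(2) pos by (simp add: field_simps)
    then have "joint_tail n (copula n M X) (?q v) \<le> (1 - p 1) * M.prob A"
      using B(2) by simp
    with tail show False
      by simp
  qed
  \<comment> \<open>Association at the conditional quantile reads
    \<open>p 1 * prob A \<le> prob A * u\<close>, or the same with \<open>B\<close> and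
    \<open>v\<close>; in the first case \<open>uv\<close> carries the bound over to
    \<open>v\<close>.\<close>
  have p_le: "p 1 \<le> v"
    using assms(13)
  proof
    assume "SI n M X"
    from M.SI_stress_event_le[OF X 1(2) this, of p x] have "p 1 \<le> u"
      using x(1) A(2) unfolding A_def[symmetric] u_def[symmetric] by (simp add: mult.commute)
    with uv show ?thesis
      by simp
  next
    assume "SI n N Y"
    from N.SI_stress_event_le[OF Y 1(2) this, of p y] show ?thesis
      using y(1) B(2) unfolding B_def[symmetric] v_def[symmetric] by (simp add: mult.commute)
  qed
  let ?a = "VaR M (X 1)" and ?b = "VaR N (Y 1)"
  have a: "?a t > 0" and b: "?b t > 0" if "0 < t" "t < 1" for t
    using M.VaR_pos[OF X1 cX[OF 1(1)] assms(6)[OF 1(1)] that]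
      N.VaR_pos[OF Y1 cY[OF 1(1)] assms(7)[OF 1(1)] that] by auto
  have "?a u / ?a (p 1) \<le> ?b v / ?b (p 1)"
  \<comment> \<open>When only \<open>Y\<close> is stochastically increasing, \<open>u\<close> may
    fall below \<open>p 1\<close>. Then monotone quantiles alone separate the two quotients by
    1.\<close>
  proof (cases "p 1 \<le> u")
    case True
    have "?b (p 1) / ?a (p 1) \<le> ?b u / ?a u"
      using mono_onD[OF assms(17)[unfolded star_le_def], of "p 1" u] True p1 x(3,4) by simp
    then have "?a u / ?a (p 1) \<le> ?b u / ?b (p 1)"
      using a[OF p1] b[OF p1] a[OF x(3,4)] by (simp add: field_simps)
    also have "\<dots> \<le> ?b v / ?b (p 1)"
      using N.VaR_mono[OF Y1 x(3) uv y(4)] b[OF p1] by (intro divide_right_mono) auto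
    finally show ?thesis .
  next
    case False
    have "?a u / ?a (p 1) \<le> 1"
      using M.VaR_mono[OF X1 x(3), of "p 1"] False p1 a[OF p1] by simp
    also have "1 \<le> ?b v / ?b (p 1)"
      using N.VaR_mono[OF Y1 p1(1) p_le y(4)] b[OF p1] by simp
    finally show ?thesis .
  qed
  \<comment> \<open>The MCoVaRs are the quantiles at levels \<open>u\<close> and \<open>v\<close>,
    and each ratio contribution is the corresponding quotient minus 1.\<close>
  then show ?thesis
    unfolding ratio_MCoVaR_def MCoVaR_def A_def[symmetric] B_def[symmetric]
      x_def[symmetric] y_def[symmetric] x(5) y(5)
    using a[OF p1] b[OF p1] by (simp add: diff_divide_distrib)
qed

end
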